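(* Let $(F_k(q))_{k\ge 0}$ be a $q$-holonomic sequence and let $L=\sum_{i=0}^{J}a_i(q^k)\sigma^i\in\operatorname{ann}F_k(q)$, with $a_i(x)\in\mathbb{K}(q)[x,x^{-1}]$ and $a_0(q^k)a_J(q^k)\neq0$, be nondegenerated. Then every Laurent polynomial $Q(x)\in\mathbb{K}(q)[x,x^{-1}]$ can be written as $$Q(x)=\tilde p(x)+\tilde Q(x),$$ where $\tilde p(x),\tilde Q(x)\in\mathbb{K}(q)[x,x^{-1}]$, $\deg\tilde Q(x)<\deg L$, and there exist rational functions $u_0(x),\dots,u_{J-1}(x)\in\mathbb{K}(q)(x)$ such that $$\tilde p(q^k)F_k(q)=\Delta\Big(\sum_{i=0}^{J-1}u_i(q^k)F_{k+i}(q)\Big).$$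
   Context: $\mathbb{K}$ is a field of characteristic zero, $q$ is an indeterminate. Sequences take values in a field containing $\mathbb{K}(q)$. The shift operator is $\sigma F_k(q)=F_{k+1}(q)$ and $\Delta=\sigma-1$, i.e. $\Delta G_k=G_{k+1}-G_k$. A sequence $(F_k(q))_{k=0}^\infty$ is $q$-holonomic if there exist an integer $J\ge 0$ and $a_0(x),\dots,a_J(x)\in\mathbb{K}(q)[x,x^{-1}]$ with $a_J(x)\ne0$ such that $\sum_{i=0}^{J}a_i(q^k)F_{k+i}(q)=0$ for all $k$. The annihilator is $\operatorname{ann}F_k(q)=\{L=\sum_i a_i(q^k)\sigma^i\in\mathbb{K}(q)[q^k,q^{-k}][\sigma]:L(F_k(q))=0\}$. For a Laurent polynomial $a(x)$, $\operatorname{hdeg}a(x)$ and $\operatorname{ldeg}a(x)$ denote the highest and lowest degree of $x$ occurring in $a(x)$, and $\deg a(x)=\operatorname{hdeg}a(x)-\operatorname{ldeg}a(x)$ (with $\operatorname{hdeg}0=-\infty$, $\operatorname{ldeg}0=+\infty$, $\deg 0=-\infty$). For $L=\sum_{i=0}^{J}a_i(q^k)\sigma^i$ put $\operatorname{hdeg}L=\max_i\operatorname{hdeg}a_i(x)$, $\operatorname{ldeg}L=\min_i\operatorname{ldeg}a_i(x)$, $\deg L=\operatorname{hdeg}L-\operatorname{ldeg}L$. Write $[x^t](a(x))$ for the coefficient of $x^t$ in $a(x)$. Put $f_L^{(t)}(s)=\sum_{i=0}^{J}[x^{t}](a_i(q^{-i}x))\,q^{-si}$ and $R_L^{t}=\{s\in\mathbb{Z}: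 f_L^{(t)}(s)=0\}$. $L$ is nondegenerated if $R_L^{\operatorname{hdeg}L}=R_L^{\operatorname{ldeg}L}=\emptyset$. Identities involving rational functions evaluated at $q^k$ are understood at those $k$ where both sides are defined. *)

theory Defs
  imports
    "HOL-Computational_Algebra.Polynomial"
    "HOL-Computational_Algebra.Fraction_Field"
    "HOL-Library.Poly_Mapping"
    "HOL-Library.Extended"
begin

section \<open>The field \<open>K(q)\<close>, Laurent polynomials and rational functions in \<open>x\<close>\<close>

type_synonym 'k Kq = "'k poly fract"

definition qq :: "'k::field_char_0 Kq" where
  "qq = Fract [:0, 1:] 1"

definition field_embedding :: "('a::field \<Rightarrow> 'b::field) \<Rightarrow> bool" where
  "field_embedding \<iota> \<longleftrightarrow> \<iota> 1 = 1 \<and> (\<forall>a b. \<iota> (a + b) = \<iota> a + \<iota> b) \<and> (\<forall>a b. \<iota> (a * b) = \<iota> a * \<iota> b)"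

text \<open>\<open>'a[x, x\<^sup>-\<^sup>1]\<close> as the group ring of \<open>\<int>\<close>: finitely supported functions with the
  convolution product. The coefficient of \<open>x\<^sup>t\<close> in \<open>a\<close> is \<open>Poly_Mapping.lookup a t\<close>.\<close>

type_synonym 'a laurent = "int \<Rightarrow>\<^sub>0 'a"

definition laurent_eval :: "'a::field laurent \<Rightarrow> 'a \<Rightarrow> 'a" where
  "laurent_eval a c = (\<Sum>t\<in>Poly_Mapping.keys a. Poly_Mapping.lookup a t * c powi t)"

definition laurent_scale :: "'a::field \<Rightarrow> 'a laurent \<Rightarrow> 'a laurent" \<comment> \<open>\<open>a(x) \<mapsto> a(c x)\<close>\<close> where
  "laurent_scale c a = Poly_Mapping.mapp (\<lambda>t v. v * c powi t) a"

definition hdeg :: "'a::zero laurent \<Rightarrow> int extended" where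
  "hdeg a = (if a = 0 then Minf else Fin (Max (Poly_Mapping.keys a)))"

definition ldeg :: "'a::zero laurent \<Rightarrow> int extended" where
  "ldeg a = (if a = 0 then Pinf else Fin (Min (Poly_Mapping.keys a)))"

definition ldegree :: "'a::zero laurent \<Rightarrow> int extended" where
  "ldegree a = hdeg a - ldeg a"

text \<open>A rational function \<open>u\<close> is defined at \<open>c\<close> iff it can be written with a denominator
  that does not vanish at \<open>c\<close>; its value there does not depend on the representation.\<close>

definition ratfun_defined :: "'a::field poly fract \<Rightarrow> 'a \<Rightarrow> bool" where
  "ratfun_defined u c \<longleftrightarrow> (\<exists>n d. poly d c \<noteq> 0 \<and> u = Fract n d)"

definition ratfun_eval :: "'a::field poly fract \<Rightarrow> 'a \<Rightarrow> 'a" where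
  "ratfun_eval u c = (THE v. \<exists>n d. poly d c \<noteq> 0 \<and> u = Fract n d \<and> v = poly n c / poly d c)"

lemma ratfun_eval_Fract:
  fixes c :: "'a::field"
  assumes "poly d c \<noteq> 0"
  shows "ratfun_eval (Fract n d) c = poly n c / poly d c"
  unfolding ratfun_eval_def
proof (rule the_equality)
  show "\<exists>n' d'. poly d' c \<noteq> 0 \<and> Fract n d = Fract n' d' \<and> poly n c / poly d c = poly n' c / poly d' c"
    using assms by blast
next
  fix v
  assume "\<exists>n' d'. poly d' c \<noteq> 0 \<and> Fract n d = Fract n' d' \<and> v = poly n' c / poly d' c"
  then obtain n' d' where d': "poly d' c \<noteq> 0" and e: "Fract n d = Fract n' d'"
    and v: "v = poly n' c / poly d' c" by blast
  have "d \<noteq> 0" "d' \<noteq> 0" using assms d' by auto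
  with e have "n * d' = n' * d" by (simp add: eq_fract)
  then have "poly n c * poly d' c = poly n' c * poly d c" by (metis poly_mult)
  then show "v = poly n c / poly d c" using assms d' v by (simp add: frac_eq_eq mult.commute)
qed


section \<open>Sequences and operators\<close>

text \<open>Sequences take values in a field \<open>'e\<close> that contains \<open>K(q)\<close> via an embedding \<open>\<iota>\<close>.\<close>

definition Delta :: "(nat \<Rightarrow> 'e::field) \<Rightarrow> nat \<Rightarrow> 'e" where
  "Delta G k = G (k + 1) - G k"

definition q_holonomic :: "('k::field_char_0 Kq \<Rightarrow> 'e::field) \<Rightarrow> (nat \<Rightarrow> 'e) \<Rightarrow> bool" where
  "q_holonomic \<iota> F \<longleftrightarrow>
     (\<exists>(J::nat) (a :: nat \<Rightarrow> 'k Kq laurent). a J \<noteq> 0 \<and>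
        (\<forall>k. (\<Sum>i\<le>J. \<iota> (laurent_eval (a i) (qq ^ k)) * F (k + i)) = 0))"

text \<open>An operator \<open>\<Sum>\<^sub>i a\<^sub>i(q\<^sup>k) \<sigma>\<^sup>i\<close> is represented by the polynomial in \<open>\<sigma>\<close> with
  coefficients \<open>a\<^sub>i(x)\<close>, so \<open>degree L\<close> is its order in \<open>\<sigma>\<close>. Only the additive structure is
  meaningful: the product of \<open>poly\<close> is not the (noncommutative) composition of operators.\<close>

type_synonym 'k qop = "'k Kq laurent poly"

definition qop_apply ::
  "('k::field_char_0 Kq \<Rightarrow> 'e::field) \<Rightarrow> 'k qop \<Rightarrow> (nat \<Rightarrow> 'e) \<Rightarrow> nat \<Rightarrow> 'e" where
  "qop_apply \<iota> L F k = (\<Sum>i\<le>degree L. \<iota> (laurent_eval (coeff L i) (qq ^ k)) * F (k + i))"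

definition ann :: "('k::field_char_0 Kq \<Rightarrow> 'e::field) \<Rightarrow> (nat \<Rightarrow> 'e) \<Rightarrow> 'k qop set" where
  "ann \<iota> F = {L. \<forall>k. qop_apply \<iota> L F k = 0}"

definition op_hdeg :: "'k::field_char_0 qop \<Rightarrow> int extended" where
  "op_hdeg L = Max ((\<lambda>i. hdeg (coeff L i)) ` {..degree L})"

definition op_ldeg :: "'k::field_char_0 qop \<Rightarrow> int extended" where
  "op_ldeg L = Min ((\<lambda>i. ldeg (coeff L i)) ` {..degree L})"

definition op_deg :: "'k::field_char_0 qop \<Rightarrow> int extended" where
  "op_deg L = op_hdeg L - op_ldeg L"

definition f_op :: "'k::field_char_0 qop \<Rightarrow> int \<Rightarrow> int \<Rightarrow> 'k Kq" where
  "f_op L t s =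
     (\<Sum>i\<le>degree L. Poly_Mapping.lookup (laurent_scale (qq powi (- int i)) (coeff L i)) t * qq powi (- s * int i))"

definition R_op :: "'k::field_char_0 qop \<Rightarrow> int \<Rightarrow> int set" where
  "R_op L t = {s. f_op L t s = 0}"

text \<open>Only a nonzero operator, whose \<open>hdeg\<close> and \<open>ldeg\<close> are integers, can be nondegenerated.\<close>

definition nondegenerated :: "'k::field_char_0 qop \<Rightarrow> bool" where
  "nondegenerated L \<longleftrightarrow>
     (\<exists>h l. op_hdeg L = Fin h \<and> op_ldeg L = Fin l \<and> R_op L h = {} \<and> R_op L l = {})"

end

theory Submission
  imports Defs
begin

text \<open>
  Multiplying the recurrence \<open>\<Sum>\<^sub>i a\<^sub>i(q\<^sup>k) F(k + i) = 0\<close> by \<open>y(q\<^sup>k)\<close>, for a Laurent polynomial \<open>y\<close>,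
  and moving every shift from \<open>F\<close> onto the coefficients (summation by parts) leaves
  \<open>p(q\<^sup>k) F(k)\<close> with \<open>p(x) = \<Sum>\<^sub>i y(q\<^sup>-\<^sup>i x) a\<^sub>i(q\<^sup>-\<^sup>i x)\<close>, up to a difference
  \<open>\<Delta>(\<Sum>\<^sub>j u\<^sub>j(q\<^sup>k) F(k + j))\<close> whose \<open>u\<^sub>j\<close> are again Laurent polynomials. So every
  \<open>p\<close> in the image of the adjoint operator \<open>y \<mapsto> p\<close> has the required form
  (\<open>adjoint_op_summable\<close>).

  It remains to see that this image contains every Laurent polynomial up to a remainder of small
  degree. For \<open>y = x\<^sup>s\<close> the coefficient of \<open>x\<^bsup>s + t\<^esup>\<close> in \<open>p\<close> is
  \<open>f_op L t s\<close>. Nondegeneracy therefore says precisely that the image of \<open>x\<^sup>s\<close> has highest degree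
  exactly \<open>s + h\<close> and lowest degree exactly \<open>s + l\<close>, for every integer \<open>s\<close>, where \<open>h\<close> and
  \<open>l\<close> are the highest and lowest degree of \<open>L\<close>. Division with remainder from above (using
  \<open>s \<ge> 0\<close>) and from below (using \<open>s < 0\<close>) then confines the exponents of the remainder to
  \<open>{l..<h}\<close> (\<open>adjoint_op_reduce\<close>), which makes its degree less than \<open>h - l\<close>.
\<close>

section \<open>Evaluating and rescaling Laurent polynomials\<close>

lemma poly_mapping_single_add_induct [case_names single add]:
  fixes a :: "'a \<Rightarrow>\<^sub>0 'b::comm_monoid_add"
  assumes single: "\<And>k v. P (Poly_Mapping.single k v)"
    and add: "\<And>f g. P f \<Longrightarrow> P g \<Longrightarrow> P (f + g)"
  shows "P a"
proof (induction a rule: update_induct)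
  case const
  show ?case using single[of undefined 0] by simp
next
  case (update f k v)
  have "Poly_Mapping.update k v f = f + Poly_Mapping.single k v"
    using update(1) by (intro poly_mapping_eqI) (auto simp: lookup_update lookup_add lookup_single in_keys_iff when_def)
  then show ?case using add[OF update(3) single] by simp
qed

lemma laurent_eval_superset:
  assumes "finite A" "Poly_Mapping.keys a \<subseteq> A"
  shows "laurent_eval a c = (\<Sum>t\<in>A. Poly_Mapping.lookup a t * c powi t)"
  unfolding laurent_eval_def
  by (rule sum.mono_neutral_left) (use assms in \<open>auto simp: in_keys_iff\<close>)

lemma laurent_eval_add: "laurent_eval (a + b) c = laurent_eval a c + laurent_eval b c"
proof -
  let ?A = "Poly_Mapping.keys a \<union> Poly_Mapping.keys b"
  have "Poly_Mapping.keys (a + b) \<subseteq> ?A" by (rule Poly_Mapping.keys_add)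
  then show ?thesis
    by (simp add: laurent_eval_superset[where A = ?A] lookup_add distrib_right sum.distrib)
qed

lemma laurent_eval_0: "laurent_eval 0 c = 0"
  by (simp add: laurent_eval_def)

lemma laurent_eval_uminus: "laurent_eval (- a) c = - laurent_eval a c"
  using laurent_eval_add[of a "- a" c] by (simp add: laurent_eval_0 eq_neg_iff_add_eq_0 add.commute)

lemma laurent_eval_sum: "laurent_eval (\<Sum>i\<in>I. b i) c = (\<Sum>i\<in>I. laurent_eval (b i) c)"
  by (induction I rule: infinite_finite_induct) (simp_all add: laurent_eval_0 laurent_eval_add)

lemma laurent_eval_single: "laurent_eval (Poly_Mapping.single s v) c = v * c powi s"
  by (simp add: laurent_eval_def)

lemma laurent_eval_single_mult:
  assumes "c \<noteq> 0"
  shows "laurent_eval (Poly_Mapping.single s v * b) c = v * c powi s * laurent_eval b c"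
proof (induction b rule: poly_mapping_single_add_induct)
  case (single t w)
  then show ?case using assms by (simp add: mult_single laurent_eval_single power_int_add)
next
  case (add f g)
  then show ?case by (simp add: distrib_left laurent_eval_add)
qed

lemma laurent_eval_mult:
  assumes "c \<noteq> 0"
  shows "laurent_eval (a * b) c = laurent_eval a c * laurent_eval b c"
proof (induction a rule: poly_mapping_single_add_induct)
  case (single s v)
  show ?case by (simp add: laurent_eval_single_mult[OF assms] laurent_eval_single)
next
  case (add f g)
  then show ?case by (simp add: distrib_right laurent_eval_add)
qed

lemma lookup_laurent_scale:
  "Poly_Mapping.lookup (laurent_scale c a) t = Poly_Mapping.lookup a t * c powi t"
  by (simp add: laurent_scale_def mapp.rep_eq in_keys_iff when_def)

lemma laurent_scale_add: "laurent_scale c (a + b) = laurent_scale c a + laurent_scale c b"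
  by (rule poly_mapping_eqI) (simp add: lookup_laurent_scale lookup_add distrib_right)

lemma laurent_eval_scale: "laurent_eval (laurent_scale c a) d = laurent_eval a (c * d)"
proof -
  have keys: "Poly_Mapping.keys (laurent_scale c a) \<subseteq> Poly_Mapping.keys a"
    by (auto simp: in_keys_iff lookup_laurent_scale)
  then show ?thesis
    unfolding laurent_eval_superset[OF finite_keys keys]
    by (simp add: laurent_eval_def lookup_laurent_scale power_int_mult_distrib mult_ac)
qed

lemma lookup_single_mult:
  fixes b :: "'a::field laurent"
  shows "Poly_Mapping.lookup (Poly_Mapping.single s v * b) t = v * Poly_Mapping.lookup b (t - s)"
proof (induction b rule: poly_mapping_single_add_induct)
  case (single r w)
  then show ?case by (auto simp: mult_single lookup_single when_def)
next
  case (add f g)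
  then show ?case by (simp add: distrib_left lookup_add)
qed

text \<open>Clearing denominators with a power of \<open>x\<close> puts a pole at \<open>0\<close> only, so the rational function
  is defined at every power of \<open>q\<close>.\<close>

lemma laurent_as_ratfun:
  fixes v :: "'a::field laurent"
  obtains u where "\<And>c. c \<noteq> 0 \<Longrightarrow> ratfun_eval u c = laurent_eval v c"
proof -
  let ?K = "Poly_Mapping.keys v"
  obtain N :: nat where N: "\<And>t. t \<in> ?K \<Longrightarrow> - int N \<le> t"
  proof
    fix t assume t: "t \<in> ?K"
    have "nat \<bar>t\<bar> \<le> (\<Sum>t\<in>?K. nat \<bar>t\<bar>)" using t by (intro member_le_sum) auto
    then show "- int (\<Sum>t\<in>?K. nat \<bar>t\<bar>) \<le> t" by linarith
  qed
  define n where "n = (\<Sum>t\<in>?K. monom (Poly_Mapping.lookup v t) (nat (t + int N)))"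
  have "ratfun_eval (Fract n (monom 1 N)) c = laurent_eval v c" if c: "c \<noteq> 0" for c
  proof -
    have "c ^ nat (t + int N) / c ^ N = c powi t" if "t \<in> ?K" for t
    proof -
      have "c ^ nat (t + int N) = c powi (t + int N)"
        using N[OF that] by (simp add: power_int_def)
      then show ?thesis using c by (simp add: power_int_add)
    qed
    then have "(\<Sum>t\<in>?K. Poly_Mapping.lookup v t * (c ^ nat (t + int N) / c ^ N)) = laurent_eval v c"
      unfolding laurent_eval_def by (intro sum.cong) auto
    then show ?thesis using c
      by (simp add: ratfun_eval_Fract poly_monom n_def poly_sum sum_divide_distrib)
  qed
  then show thesis by (rule that)
qed

section \<open>Summation by parts\<close>

text \<open>Here \<open>\<beta> i n\<close> stands for \<open>b\<^sub>i(q\<^sup>n)\<close>, with \<open>n\<close> an integer because the shifted arguments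
  \<open>k - i\<close> may be negative. The sum under \<open>Delta\<close> comes from
  \<open>\<sigma>\<^sup>i - 1 = \<Delta> (1 + \<sigma> + \<dots> + \<sigma>\<^bsup>i - 1\<^esup>)\<close>, applied to \<open>b\<^sub>i(q\<^bsup>k - i\<^esup>) F(k)\<close>.\<close>

lemma Delta_Abel:
  fixes \<beta> :: "nat \<Rightarrow> int \<Rightarrow> 'e::field" and F :: "nat \<Rightarrow> 'e"
  assumes rec: "(\<Sum>i\<le>J. \<beta> i (int k) * F (k + i)) = 0"
  shows "(\<Sum>i\<le>J. \<beta> i (int k - int i)) * F k
       = Delta (\<lambda>n. \<Sum>j<J. - (\<Sum>i\<in>{j<..J}. \<beta> i (int n + int j - int i)) * F (n + j)) k"
proof -
  define U where "U j n = - (\<Sum>i\<in>{j<..J}. \<beta> i (n + int j - int i))" for j n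
  \<comment> \<open>This relation for \<open>U\<close> turns the difference into a telescoping sum over \<open>j\<close>.\<close>
  have step: "U j (int k + 1) = U (Suc j) (int k) - \<beta> (Suc j) (int k)" if "j < J" for j
  proof -
    have "{j<..J} = insert (Suc j) {Suc j<..J}" using that by auto
    then show ?thesis by (simp add: U_def algebra_simps)
  qed
  have UJ: "U J n = 0" for n by (simp add: U_def)
  have U0: "(\<Sum>i\<le>J. \<beta> i (int k - int i)) = \<beta> 0 (int k) - U 0 (int k)"
  proof -
    have "{..J} = insert 0 {0<..J}" by auto
    then show ?thesis by (simp add: U_def)
  qed
  have rec': "(\<Sum>j<J. \<beta> (Suc j) (int k) * F (k + Suc j)) = - (\<beta> 0 (int k) * F k)"
    using rec by (simp add: sum.atMost_shift eq_neg_iff_add_eq_0 add.commute)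
  have "Delta (\<lambda>n. \<Sum>j<J. U j (int n) * F (n + j)) k
      = (\<Sum>j<J. U j (int k + 1) * F (k + Suc j)) - (\<Sum>j<J. U j (int k) * F (k + j))"
    by (simp add: Delta_def add.commute)
  also have "(\<Sum>j<J. U j (int k + 1) * F (k + Suc j))
      = (\<Sum>j<J. U (Suc j) (int k) * F (k + Suc j)) - (\<Sum>j<J. \<beta> (Suc j) (int k) * F (k + Suc j))"
    by (simp add: step left_diff_distrib sum_subtractf)
  also have "\<dots> - (\<Sum>j<J. U j (int k) * F (k + j))
      = (\<Sum>j<J. U (Suc j) (int k) * F (k + Suc j) - U j (int k) * F (k + j)) + \<beta> 0 (int k) * F k"
    unfolding rec' by (simp add: sum_subtractf)
  also have "(\<Sum>j<J. U (Suc j) (int k) * F (k + Suc j) - U j (int k) * F (k + j)) = - U 0 (int k) * F k"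
    using sum_lessThan_telescope[of "\<lambda>j. U j (int k) * F (k + j)" J] by (simp add: UJ)
  finally show ?thesis
    unfolding U0 by (simp add: U_def algebra_simps)
qed

section \<open>The adjoint operator\<close>

text \<open>The formal adjoint \<open>\<Sum>\<^sub>i \<sigma>\<^sup>-\<^sup>i a\<^sub>i(q\<^sup>k)\<close> of \<open>L\<close>, acting on Laurent polynomials in
  \<open>x = q\<^sup>k\<close>, where \<open>\<sigma>\<close> acts as \<open>x \<mapsto> q x\<close>.\<close>

definition adjoint_op :: "'k::field_char_0 qop \<Rightarrow> 'k Kq laurent \<Rightarrow> 'k Kq laurent" where
  "adjoint_op L y = (\<Sum>i\<le>degree L. laurent_scale (qq powi (- int i)) (y * coeff L i))"

lemma adjoint_op_add: "adjoint_op L (y + z) = adjoint_op L y + adjoint_op L z"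
  by (simp add: adjoint_op_def distrib_right laurent_scale_add sum.distrib)

lemma adjoint_op_0: "adjoint_op L 0 = 0"
  using adjoint_op_add[of L 0 0] by (simp only: add_0_right add_cancel_right_right)

lemma qq_nonzero: "(qq :: 'k::field_char_0 Kq) \<noteq> 0"
  by (simp add: qq_def Zero_fract_def eq_fract)

text \<open>This identity is what links nondegeneracy to the image of the adjoint: the extreme
  coefficients of the image of \<open>x\<^sup>s\<close> are the values that nondegeneracy forbids to vanish.\<close>

lemma lookup_adjoint_op_single:
  fixes L :: "'k::field_char_0 qop"
  shows "Poly_Mapping.lookup (adjoint_op L (Poly_Mapping.single s v)) t = v * f_op L (t - s) s"
proof -
  have "((qq :: 'k Kq) powi (- int i)) powi t
      = (qq powi (- int i)) powi (t - s) * qq powi (- s * int i)" for i :: nat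
  proof -
    have "- int i * t = - int i * (t - s) + - s * int i" by (simp add: algebra_simps)
    then show ?thesis by (metis power_int_add power_int_mult qq_nonzero)
  qed
  then show ?thesis
    by (simp add: adjoint_op_def f_op_def lookup_sum lookup_laurent_scale lookup_single_mult
        sum_distrib_left mult_ac)
qed

lemma f_op_eq_0:
  assumes "op_hdeg L = Fin h" "op_ldeg L = Fin l" "t \<notin> {l..h}"
  shows "f_op L t s = 0"
proof -
  have "Poly_Mapping.lookup (coeff L i) t = 0" if i: "i \<le> degree L" for i
  proof (rule ccontr)
    assume *: "Poly_Mapping.lookup (coeff L i) t \<noteq> 0"
    then have t: "t \<in> Poly_Mapping.keys (coeff L i)" and "coeff L i \<noteq> 0"
      by (auto simp: in_keys_iff)
    moreover have "hdeg (coeff L i) \<le> Fin h" "Fin l \<le> ldeg (coeff L i)"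
      using assms(1,2) i unfolding op_hdeg_def op_ldeg_def
      by (metis Max_ge atMost_iff finite_atMost finite_imageI image_eqI,
          metis Min_le atMost_iff finite_atMost finite_imageI image_eqI)
    ultimately have "Max (Poly_Mapping.keys (coeff L i)) \<le> h" "l \<le> Min (Poly_Mapping.keys (coeff L i))"
      by (auto simp: hdeg_def ldeg_def)
    then show False using assms(3) Max_ge[OF finite_keys t] Min_le[OF finite_keys t] by auto
  qed
  then show ?thesis by (simp add: f_op_def lookup_laurent_scale)
qed

text \<open>Subtracting a multiple of the image of \<open>x\<^sup>s\<close> with \<open>s \<ge> 0\<close> removes the exponent \<open>h + s\<close> and
  touches no exponent below \<open>l + s \<ge> l\<close>; with \<open>s < 0\<close> it removes \<open>l + s\<close> and touches none above
  \<open>h + s < h\<close>. Hence the two eliminations do not undo each other.\<close>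

lemma adjoint_op_reduce:
  assumes h: "op_hdeg L = Fin h" and l: "op_ldeg L = Fin l"
    and Rh: "R_op L h = {}" and Rl: "R_op L l = {}"
  shows "\<exists>y. Poly_Mapping.keys (Q - adjoint_op L y) \<subseteq> {l..<h}"
proof -
  note vanish = f_op_eq_0[OF h l]
  have fh: "f_op L h s \<noteq> 0" and fl: "f_op L l s \<noteq> 0" for s
    using Rh Rl by (auto simp: R_op_def)
  have low: "\<exists>y. Poly_Mapping.keys (Q - adjoint_op L y) \<subseteq> {l..<h}"
    if "Poly_Mapping.keys Q \<subseteq> {l - int m..<h}" for m Q
    using that
  proof (induction m arbitrary: Q)
    case 0
    then show ?case by (intro exI[of _ 0]) (simp add: adjoint_op_0)
  next
    case (Suc m)
    define s where "s = - int (Suc m)"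
    define z where "z = Poly_Mapping.single s (Poly_Mapping.lookup Q (l + s) / f_op L l s)"
    have "Poly_Mapping.keys (Q - adjoint_op L z) \<subseteq> {l - int m..<h}"
    proof
      fix t assume "t \<in> Poly_Mapping.keys (Q - adjoint_op L z)"
      then have nz: "Poly_Mapping.lookup Q t \<noteq> Poly_Mapping.lookup Q (l + s) / f_op L l s * f_op L (t - s) s"
        by (simp add: in_keys_iff lookup_minus z_def lookup_adjoint_op_single)
      have "t \<noteq> l + s" using nz fl by auto
      moreover have "t \<in> {l + s..<h}"
      proof (cases "t - s \<in> {l..h}")
        case True then show ?thesis by (auto simp: s_def)
      next
        case False
        then show ?thesis using nz vanish[OF False] Suc.prems by (auto simp: s_def in_keys_iff)
      qed
      ultimately show "t \<in> {l - int m..<h}" by (auto simp: s_def)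
    qed
    then obtain y where "Poly_Mapping.keys (Q - adjoint_op L z - adjoint_op L y) \<subseteq> {l..<h}"
      using Suc.IH by blast
    then show ?case by (intro exI[of _ "z + y"]) (simp add: adjoint_op_add diff_diff_eq)
  qed
  have high: "\<exists>y. Poly_Mapping.keys (Q - adjoint_op L y) \<subseteq> {l..<h}"
    if "Poly_Mapping.keys Q \<subseteq> {l - int m..<h + int n}" for m n Q
    using that
  proof (induction n arbitrary: Q)
    case 0
    then show ?case using low by simp
  next
    case (Suc n)
    define s where "s = int n"
    define z where "z = Poly_Mapping.single s (Poly_Mapping.lookup Q (h + s) / f_op L h s)"
    have "Poly_Mapping.keys (Q - adjoint_op L z) \<subseteq> {l - int m..<h + int n}"
    proof
      fix t assume "t \<in> Poly_Mapping.keys (Q - adjoint_op L z)"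
      then have nz: "Poly_Mapping.lookup Q t \<noteq> Poly_Mapping.lookup Q (h + s) / f_op L h s * f_op L (t - s) s"
        by (simp add: in_keys_iff lookup_minus z_def lookup_adjoint_op_single)
      have "t \<noteq> h + s" using nz fh by auto
      moreover have "t \<in> {l - int m..h + s}"
      proof (cases "t - s \<in> {l..h}")
        case True then show ?thesis by (auto simp: s_def)
      next
        case False
        then show ?thesis using nz vanish[OF False] Suc.prems by (auto simp: s_def in_keys_iff)
      qed
      ultimately show "t \<in> {l - int m..<h + int n}" by (auto simp: s_def)
    qed
    then obtain y where "Poly_Mapping.keys (Q - adjoint_op L z - adjoint_op L y) \<subseteq> {l..<h}"
      using Suc.IH by blast
    then show ?case by (intro exI[of _ "z + y"]) (simp add: adjoint_op_add diff_diff_eq)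
  qed
  define N where "N = (\<Sum>t\<in>Poly_Mapping.keys Q. nat \<bar>t\<bar>)"
  have "nat \<bar>t\<bar> \<le> N" if "t \<in> Poly_Mapping.keys Q" for t
    unfolding N_def using that by (intro member_le_sum) auto
  then have "Poly_Mapping.keys Q \<subseteq> {l - int (nat \<bar>l\<bar> + N)..<h + int (nat \<bar>h\<bar> + N + 1)}"
    by fastforce
  then show ?thesis by (rule high)
qed

lemma ldegree_less:
  assumes "Poly_Mapping.keys (Q::'a::zero laurent) \<subseteq> {l..<h}"
  shows "ldegree Q < Fin h - Fin l"
proof (cases "Q = 0")
  case True then show ?thesis by (simp add: ldegree_def hdeg_def ldeg_def)
next
  case False
  then have "Poly_Mapping.keys Q \<noteq> {}" by simp
  then have "Max (Poly_Mapping.keys Q) \<in> {l..<h}" "Min (Poly_Mapping.keys Q) \<in> {l..<h}"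
    using assms Max_in[of "Poly_Mapping.keys Q"] Min_in[of "Poly_Mapping.keys Q"] finite_keys by blast+
  then have "Max (Poly_Mapping.keys Q) - Min (Poly_Mapping.keys Q) < h - l"
    unfolding atLeastLessThan_iff by linarith
  then show ?thesis using False by (simp add: ldegree_def hdeg_def ldeg_def)
qed

section \<open>Summability of the image of the adjoint\<close>

lemma field_embedding_0: "field_embedding \<iota> \<Longrightarrow> \<iota> 0 = 0"
  unfolding field_embedding_def by (metis add_cancel_right_left)

lemma field_embedding_sum:
  assumes "field_embedding \<iota>" shows "\<iota> (\<Sum>i\<in>I. g i) = (\<Sum>i\<in>I. \<iota> (g i))"
proof (induction I rule: infinite_finite_induct)
  case (insert x I)
  then show ?case using assms by (simp add: field_embedding_def)
qed (simp_all add: field_embedding_0[OF assms])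

lemma field_embedding_uminus:
  assumes "field_embedding \<iota>" shows "\<iota> (- a) = - \<iota> a"
proof -
  have "\<iota> (- a) + \<iota> a = \<iota> (- a + a)" using assms unfolding field_embedding_def by metis
  then show ?thesis using field_embedding_0[OF assms] by (simp add: eq_neg_iff_add_eq_0)
qed

lemma adjoint_op_summable:
  assumes \<iota>: "field_embedding \<iota>" and L: "L \<in> ann \<iota> F"
  shows "\<exists>u. \<forall>k. \<iota> (laurent_eval (adjoint_op L y) (qq ^ k)) * F k
            = Delta (\<lambda>n. \<Sum>i<degree L. \<iota> (ratfun_eval (u i) (qq ^ n)) * F (n + i)) k"
proof -
  define \<beta> where "\<beta> i n = \<iota> (laurent_eval (y * coeff L i) (qq powi n))" for i and n :: int
  define v where "v j = - (\<Sum>i\<in>{j<..degree L}. laurent_scale (qq powi (int j - int i)) (y * coeff L i))" for j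
  have "\<forall>j. \<exists>u. \<forall>c. c \<noteq> 0 \<longrightarrow> ratfun_eval u c = laurent_eval (v j) c"
    using laurent_as_ratfun by metis
  then obtain u where u: "\<And>j c. c \<noteq> 0 \<Longrightarrow> ratfun_eval (u j) c = laurent_eval (v j) c"
    by metis
  have shift: "qq powi m * qq ^ n = qq powi (int n + m)" for m and n :: nat
    by (simp add: power_int_add qq_nonzero mult.commute)
  have uv: "\<iota> (ratfun_eval (u j) (qq ^ n)) = - (\<Sum>i\<in>{j<..degree L}. \<beta> i (int n + int j - int i))" for j n
    by (simp add: u qq_nonzero v_def \<beta>_def laurent_eval_uminus laurent_eval_sum laurent_eval_scale
        shift add_diff_eq field_embedding_uminus[OF \<iota>] field_embedding_sum[OF \<iota>])
  have p: "\<iota> (laurent_eval (adjoint_op L y) (qq ^ k)) = (\<Sum>i\<le>degree L. \<beta> i (int k - int i))" for k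
    by (simp add: adjoint_op_def \<beta>_def laurent_eval_sum laurent_eval_scale shift
        field_embedding_sum[OF \<iota>])
  \<comment> \<open>the annihilating recurrence multiplied by \<open>y(q\<^sup>k)\<close>\<close>
  have rec: "(\<Sum>i\<le>degree L. \<beta> i (int k) * F (k + i)) = 0" for k
  proof -
    have "(\<Sum>i\<le>degree L. \<beta> i (int k) * F (k + i)) = \<iota> (laurent_eval y (qq ^ k)) * qop_apply \<iota> L F k"
      using \<iota> by (simp add: \<beta>_def laurent_eval_mult qq_nonzero field_embedding_def qop_apply_def
          sum_distrib_left mult.assoc)
    then show ?thesis using L by (simp add: ann_def)
  qed
  have "\<iota> (laurent_eval (adjoint_op L y) (qq ^ k)) * F k
      = Delta (\<lambda>n. \<Sum>i<degree L. \<iota> (ratfun_eval (u i) (qq ^ n)) * F (n + i)) k" for k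
    unfolding p uv by (rule Delta_Abel) (rule rec)
  then show ?thesis by blast
qed

section \<open>Reduction modulo summable terms\<close>

theorem mainTheorem2:
  fixes \<iota> :: "'k::field_char_0 Kq \<Rightarrow> 'e::field"
    and F :: "nat \<Rightarrow> 'e"
    and L :: "'k qop"
    and J :: nat
    and a :: "nat \<Rightarrow> 'k Kq laurent"
    and Q :: "'k Kq laurent"
  assumes "field_embedding \<iota>"
    and "q_holonomic \<iota> F"
    and "L = (\<Sum>i\<le>J. monom (a i) i)"
    and "L \<in> ann \<iota> F"
    and "a 0 * a J \<noteq> 0"
    and "nondegenerated L"
  shows "\<exists>(p :: 'k Kq laurent) (Q' :: 'k Kq laurent) (u :: nat \<Rightarrow> 'k Kq poly fract).
           Q = p + Q' \<and>
           ldegree Q' < op_deg L \<and>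
           (\<forall>k. (\<forall>i<J. ratfun_defined (u i) (qq ^ k) \<and> ratfun_defined (u i) (qq ^ (k + 1))) \<longrightarrow>
                \<iota> (laurent_eval p (qq ^ k)) * F k
                = Delta (\<lambda>n. \<Sum>i<J. \<iota> (ratfun_eval (u i) (qq ^ n)) * F (n + i)) k)"
proof -
  have "coeff L i = (if i \<le> J then a i else 0)" for i
    by (simp add: assms(3) coeff_sum)
  moreover have "a J \<noteq> 0" using assms(5) by auto
  ultimately have deg: "degree L = J"
    by (intro antisym degree_le le_degree) auto
  obtain h l where hl: "op_hdeg L = Fin h" "op_ldeg L = Fin l" "R_op L h = {}" "R_op L l = {}"
    using assms(6) unfolding nondegenerated_def by blast
  obtain y where y: "Poly_Mapping.keys (Q - adjoint_op L y) \<subseteq> {l..<h}"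
    using adjoint_op_reduce[OF hl] by blast
  obtain u where u: "\<And>k. \<iota> (laurent_eval (adjoint_op L y) (qq ^ k)) * F k
            = Delta (\<lambda>n. \<Sum>i<J. \<iota> (ratfun_eval (u i) (qq ^ n)) * F (n + i)) k"
    using adjoint_op_summable[OF assms(1,4), of y] unfolding deg by blast
  have "ldegree (Q - adjoint_op L y) < op_deg L"
    using ldegree_less[OF y] by (simp only: op_deg_def hl(1,2))
  then show ?thesis
    by (intro exI[of _ "adjoint_op L y"] exI[of _ "Q - adjoint_op L y"] exI[of _ u]) (simp add: u)
qed
end
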